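(* Let $f_i\colon\mathbb{R}^n\to(-\infty,\infty]$, $i=1,\ldots,m$, be convex functions, and let $\bar{x}\in\bigcap_{i=1}^m\mathrm{dom}(f_i)$ be such that each $f_i$ is continuous at $\bar{x}$. Let $f(x):=\max_{i=1,\ldots,m}f_i(x)$ for $x\in\mathbb{R}^n$, and let $I(\bar{x}):=\{i\in\{1,\ldots,m\} : f_i(\bar{x})=f(\bar{x})\}$. Then $$\partial f(\bar{x})=\mathrm{co}\Big(\bigcup_{i\in I(\bar{x})}\partial f_i(\bar{x})\Big).$$
   Context: For $f\colon\mathbb{R}^n\to(-\infty,\infty]$, $\mathrm{dom}(f):=\{x : f(x)<\infty\}$. For a convex function $f$ and $\bar{x}\in\mathrm{dom}(f)$, the subdifferential is $\partial f(\bar{x}):=\{v\in\mathbb{R}^n : f(x)\ge f(\bar{x})+\langle v,x-\bar{x}\rangle\text{ for all }x\in\mathbb{R}^n\}$. $\mathrm{co}(\cdot)$ denotes the convex hull. *)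

theory Defs
  imports "HOL-Analysis.Analysis"
begin

(* Functions into (-\<infinity>, \<infinity>] are modelled as ereal-valued functions that never take the value
   -\<infinity>; this is part of ext_convex, so the right-hand side of the convexity inequality never
   involves \<infinity> - \<infinity>. *)

definition effdom :: "('a \<Rightarrow> ereal) \<Rightarrow> 'a set"
  where "effdom f = {x. f x < \<infinity>}"

definition ext_convex :: "('a::real_vector \<Rightarrow> ereal) \<Rightarrow> bool"
  where "ext_convex f \<longleftrightarrow>
    (\<forall>x. f x \<noteq> -\<infinity>) \<and>
    (\<forall>x y. \<forall>t::real. 0 < t \<and> t < 1 \<longrightarrow>
      f (t *\<^sub>R x + (1 - t) *\<^sub>R y) \<le> ereal t * f x + ereal (1 - t) * f y)"

(* Meaningful only at points xb of effdom f. *)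
definition subdifferential :: "('a::real_inner \<Rightarrow> ereal) \<Rightarrow> 'a \<Rightarrow> 'a set"
  where "subdifferential f xb = {v. \<forall>x. f x \<ge> f xb + ereal (v \<bullet> (x - xb))}"

definition max_fun :: "nat \<Rightarrow> (nat \<Rightarrow> 'a \<Rightarrow> ereal) \<Rightarrow> 'a \<Rightarrow> ereal"
  where "max_fun m f x = Max ((\<lambda>i. f i x) ` {1..m})"

definition active_indices :: "nat \<Rightarrow> (nat \<Rightarrow> 'a \<Rightarrow> ereal) \<Rightarrow> 'a \<Rightarrow> nat set"
  where "active_indices m f xb = {i \<in> {1..m}. f i xb = max_fun m f xb}"

end

theory Submission
  imports Defs
begin

text \<open>
  A subgradient of any active \<open>f i\<close> supports the maximum as well, because \<open>f i\<close> lies below the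
  maximum and touches it at \<open>xb\<close>; as subdifferentials are convex, this gives the inclusion of the
  convex hull.

  Conversely, let \<open>v\<close> lie outside the convex hull \<open>C\<close>. Continuity makes every
  \<open>subdifferential (f i) xb\<close> compact, hence \<open>C\<close> is compact, and a direction \<open>d\<close> and a number \<open>b\<close>
  exist with \<open>w \<bullet> d < b\<close> for all \<open>w \<in> C\<close> but \<open>b < v \<bullet> d\<close>. No active \<open>f i\<close> can grow from \<open>xb\<close> along
  \<open>d\<close> at rate at least \<open>b\<close> on the whole ray: by \<open>subgradient_of_slope\<close>, a form of the Hahn-Banach theorem,
  such growth would produce a subgradient \<open>w \<in> C\<close> with \<open>w \<bullet> d \<ge> b\<close>. Convexity then keeps the
  growth rate of the active functions at most \<open>b\<close> for all small steps (\<open>eventually_below_slope\<close>),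
  and the inactive functions, being smaller than the maximum at \<open>xb\<close>, stay below the same ray by
  continuity. So the maximum grows along \<open>d\<close> at rate at most \<open>b < v \<bullet> d\<close>, and \<open>v\<close> is not a subgradient of it.
\<close>

section \<open>Extended-valued convex functions\<close>

lemma ext_convexD:
  assumes "ext_convex f" "0 < t" "t < 1"
  shows "f (t *\<^sub>R x + (1 - t) *\<^sub>R y) \<le> ereal t * f x + ereal (1 - t) * f y"
  using assms unfolding ext_convex_def by blast

lemma ext_convex_real_value:
  assumes "ext_convex f" "x \<in> effdom f"
  obtains r where "f x = ereal r"
  using assms unfolding ext_convex_def effdom_def by (cases "f x") auto

lemma convex_epigraph_ext_convex:
  assumes "ext_convex f"
  shows "convex {(x, r). f x \<le> ereal r}"
  unfolding convex_alt
proof (intro ballI allI impI)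
  fix z z' and t :: real
  assume zz': "z \<in> {(x, r). f x \<le> ereal r}" "z' \<in> {(x, r). f x \<le> ereal r}"
    and "0 \<le> t \<and> t \<le> 1"
  then have t: "0 \<le> t" "t \<le> 1" by simp_all
  obtain x r y s where z: "z = (x, r)" "z' = (y, s)" by (cases z, cases z')
  have xr: "f x \<le> ereal r" and ys: "f y \<le> ereal s" using zz' z by auto
  have "f ((1 - t) *\<^sub>R x + t *\<^sub>R y) \<le> ereal ((1 - t) * r + t * s)"
  proof (cases "t = 0 \<or> t = 1")
    case True
    then show ?thesis using xr ys by auto
  next
    case False
    then have t': "0 < t" "t < 1" using t by auto
    have "f ((1 - t) *\<^sub>R x + t *\<^sub>R y) \<le> ereal t * f y + ereal (1 - t) * f x"
      using ext_convexD[OF assms t', of y x] by (simp add: add.commute)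
    also have "\<dots> \<le> ereal t * ereal s + ereal (1 - t) * ereal r"
      using xr ys t by (intro add_mono ereal_mult_left_mono) auto
    finally show ?thesis by (simp add: add.commute)
  qed
  then show "(1 - t) *\<^sub>R z + t *\<^sub>R z' \<in> {(x, r). f x \<le> ereal r}"
    by (simp add: z)
qed

lemma isCont_locally_bounded_above:
  fixes f :: "'a::metric_space \<Rightarrow> ereal"
  assumes "isCont f xb" "xb \<in> effdom f"
  obtains \<delta> M where "\<delta> > 0" "\<And>x. dist x xb < \<delta> \<Longrightarrow> f x \<le> ereal M"
proof -
  have "f xb < \<infinity>" using assms(2) by (simp add: effdom_def)
  then obtain M where M: "f xb < ereal M" using ereal_dense2 by blast
  have "\<forall>\<^sub>F x in nhds xb. f x < ereal M"
    using assms(1) M unfolding isCont_def tendsto_at_iff_tendsto_nhds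
    by (rule order_tendstoD(2))
  then obtain \<delta> where "\<delta> > 0" "\<forall>x. dist x xb < \<delta> \<longrightarrow> f x < ereal M"
    unfolding eventually_nhds_metric by blast
  then show thesis using that by (meson less_imp_le)
qed

section \<open>Topology of the subdifferential\<close>

text \<open>
  Testing the subgradient inequality on the epigraph instead of the graph replaces the extended
  values by real ones and exhibits the subdifferential as an intersection of closed half-spaces.
\<close>

lemma subdifferential_halfspaces:
  assumes "f xb = ereal c"
  shows "subdifferential f xb =
    (\<Inter>(x, r) \<in> {(x, r). f x \<le> ereal r}. {v. (x - xb) \<bullet> v \<le> r - c})" (is "?L = ?R")
proof (intro equalityI subsetI)
  fix v assume v: "v \<in> ?L"
  have "(x - xb) \<bullet> v \<le> r - c" if "f x \<le> ereal r" for x r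
  proof -
    have "ereal c + ereal (v \<bullet> (x - xb)) \<le> f x"
      using v assms unfolding subdifferential_def by auto
    also note that
    finally have "ereal c + ereal (v \<bullet> (x - xb)) \<le> ereal r" .
    then show ?thesis by (simp add: inner_commute)
  qed
  then show "v \<in> ?R" by auto
next
  fix v assume v: "v \<in> ?R"
  have "f xb + ereal (v \<bullet> (x - xb)) \<le> f x" for x
  proof (rule ereal_le_real)
    fix r assume "f x \<le> ereal r"
    then have "(x - xb) \<bullet> v \<le> r - c" using v by auto
    then show "f xb + ereal (v \<bullet> (x - xb)) \<le> ereal r"
      using assms by (simp add: inner_commute)
  qed
  then show "v \<in> ?L" by (simp add: subdifferential_def)
qed

lemma
  assumes "f xb = ereal c"
  shows convex_subdifferential: "convex (subdifferential f xb)"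
    and closed_subdifferential: "closed (subdifferential f xb)"
  unfolding subdifferential_halfspaces[of f, OF assms]
  by (auto intro!: convex_INT closed_INT convex_halfspace_le closed_halfspace_le)

text \<open>
  A local upper bound \<open>M\<close> on a ball of radius \<open>\<delta>\<close> bounds the norm of every subgradient: moving from
  \<open>xb\<close> by \<open>\<delta> / 2\<close> in the direction of \<open>v\<close> raises the supporting affine function by
  \<open>\<delta> / 2 * norm v\<close>, and the result must stay below \<open>M\<close>.
\<close>

lemma compact_subdifferential:
  fixes f :: "'a::euclidean_space \<Rightarrow> ereal"
  assumes "ext_convex f" "xb \<in> effdom f" "isCont f xb"
  shows "compact (subdifferential f xb)"
proof -
  obtain c where c: "f xb = ereal c" using ext_convex_real_value assms by blast
  obtain \<delta> M where \<delta>: "\<delta> > 0" and M: "\<And>x. dist x xb < \<delta> \<Longrightarrow> f x \<le> ereal M"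
    using isCont_locally_bounded_above assms by blast
  have "norm v \<le> (M - c) / (\<delta> / 2)" if v: "v \<in> subdifferential f xb" for v
  proof -
    let ?x = "xb + (\<delta> / 2) *\<^sub>R sgn v"
    have "dist ?x xb < \<delta>" using \<delta> by (simp add: dist_norm norm_sgn)
    then have "f ?x \<le> ereal M" by (rule M)
    then have "(?x - xb) \<bullet> v \<le> M - c"
      using v unfolding subdifferential_halfspaces[of f, OF c] by blast
    moreover have "sgn v \<bullet> v = norm v"
      by (cases "v = 0") (simp_all add: sgn_div_norm dot_square_norm power2_eq_square)
    ultimately show ?thesis using \<delta> by (simp add: field_simps)
  qed
  then have "bounded (subdifferential f xb)" by (rule boundedI)
  then show ?thesis using closed_subdifferential[of f, OF c] by (simp add: compact_eq_bounded_closed)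
qed

section \<open>Growth along a direction\<close>

text \<open>
  The ray of slope \<open>b\<close> issuing from \<open>(xb, f xb)\<close> over the direction \<open>d\<close> lies below the graph, so the
  region under this ray can be separated from the epigraph. The separating hyperplane
  passes through \<open>(xb, f xb)\<close>. It is not vertical because \<open>f\<close> is finite around \<open>xb\<close>, hence it is the
  graph of an affine function; its slope is the desired subgradient.
\<close>

lemma subgradient_of_slope:
  fixes f :: "'a::euclidean_space \<Rightarrow> ereal"
  assumes conv: "ext_convex f" and dom: "xb \<in> effdom f" and cont: "isCont f xb"
    and slope: "\<And>s. s > 0 \<Longrightarrow> f xb + ereal (s * b) \<le> f (xb + s *\<^sub>R d)"
  obtains w where "w \<in> subdifferential f xb" "b \<le> w \<bullet> d"
proof -
  obtain c where c: "f xb = ereal c" using ext_convex_real_value conv dom by blast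
  obtain \<delta> M where \<delta>: "\<delta> > 0" and M: "\<And>x. dist x xb < \<delta> \<Longrightarrow> f x \<le> ereal M"
    using isCont_locally_bounded_above cont dom by blast
  define S where "S = {(x, r). f x \<le> ereal r}"
  define T where "T = {(xb + s *\<^sub>R d, r) | s r. 0 \<le> s \<and> r < c + s * b}"
  have T_I: "(xb + s *\<^sub>R d, r) \<in> T" if "0 \<le> s" "r < c + s * b" for s r
    using that unfolding T_def by blast
  have "convex T"
    unfolding convex_alt
  proof clarify
    fix x r y q and t :: real
    assume "(x, r) \<in> T" "(y, q) \<in> T" and t: "0 \<le> t" "t \<le> 1"
    then obtain s1 s2 where x: "x = xb + s1 *\<^sub>R d" "0 \<le> s1" "r < c + s1 * b"
      and y: "y = xb + s2 *\<^sub>R d" "0 \<le> s2" "q < c + s2 * b"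
      unfolding T_def by auto
    let ?s = "(1 - t) * s1 + t * s2"
    have "(1 - t) *\<^sub>R (x, r) + t *\<^sub>R (y, q) = (xb + ?s *\<^sub>R d, (1 - t) * r + t * q)"
      by (simp add: x y algebra_simps)
    moreover have "0 \<le> ?s" using t x y by simp
    moreover have "(1 - t) * r + t * q < (1 - t) * (c + s1 * b) + t * (c + s2 * b)"
      using convex_bound_lt[of "r - (c + s1 * b)" 0 "q - (c + s2 * b)" "1 - t" t] x y t
      by (simp add: algebra_simps)
    then have "(1 - t) * r + t * q < c + ?s * b" by (simp add: algebra_simps)
    ultimately show "(1 - t) *\<^sub>R (x, r) + t *\<^sub>R (y, q) \<in> T" using T_I by simp
  qed
  moreover have "convex S" unfolding S_def by (rule convex_epigraph_ext_convex[OF conv])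
  moreover have "(xb, c) \<in> S" by (simp add: S_def c)
  moreover have "(xb, c - 1) \<in> T" using T_I[of 0] by simp
  moreover have "S \<inter> T = {}"
  proof -
    have False if s: "0 \<le> s" "r < c + s * b" and r: "f (xb + s *\<^sub>R d) \<le> ereal r" for s r
    proof -
      have "ereal (c + s * b) \<le> f (xb + s *\<^sub>R d)"
        using slope[of s] s c by (cases "s = 0") auto
      then have "ereal (c + s * b) \<le> ereal r" using r by (rule order_trans)
      then show False using s by simp
    qed
    then show ?thesis unfolding S_def T_def by auto
  qed
  ultimately obtain a \<beta> where a: "a \<noteq> 0" and aS: "\<And>z. z \<in> S \<Longrightarrow> a \<bullet> z \<le> \<beta>"
    and aT: "\<And>z. z \<in> T \<Longrightarrow> \<beta> \<le> a \<bullet> z"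
    using separating_hyperplane_sets[of S T] by blast
  obtain p q where pq: "a = (p, q)" by (cases a)
  have S: "p \<bullet> x + q * r \<le> \<beta>" if "f x \<le> ereal r" for x r
    using aS[of "(x, r)"] that by (simp add: S_def pq)
  have T: "\<beta> \<le> p \<bullet> (xb + s *\<^sub>R d) + q * r" if "0 \<le> s" "r < c + s * b" for s r
    using aT[OF T_I[OF that]] by (simp add: pq)
  \<comment> \<open>A vertical hyperplane would leave the whole ball around \<open>xb\<close> on one side of its base, although
    \<open>xb\<close> itself lies on that base.\<close>
  have "q \<noteq> 0"
  proof
    assume q: "q = 0"
    have "dist (xb + (\<delta> / 2) *\<^sub>R sgn p) xb < \<delta>" using \<delta> by (simp add: dist_norm norm_sgn)
    then have "p \<bullet> (xb + (\<delta> / 2) *\<^sub>R sgn p) \<le> \<beta>" using S[OF M] q by simp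
    moreover have "\<beta> \<le> p \<bullet> xb" using T[of 0 "c - 1"] q by simp
    moreover have "p \<bullet> sgn p = norm p"
      by (cases "p = 0") (simp_all add: sgn_div_norm dot_square_norm power2_eq_square)
    ultimately have "(\<delta> / 2) * norm p \<le> 0" by (simp add: inner_add_right)
    then have "p = 0" using \<delta> by (simp add: mult_le_0_iff)
    then show False using a q pq by (simp add: zero_prod_def)
  qed
  moreover have "q \<le> 0"
    using order_trans[OF S[of xb c] T[of 0 "c - 1"]] c by (simp add: algebra_simps)
  ultimately have q: "q < 0" by simp
  \<comment> \<open>Letting \<open>r\<close> increase to the ray puts the ray itself on the closed side of the hyperplane.\<close>
  have ray: "\<beta> \<le> p \<bullet> (xb + s *\<^sub>R d) + q * (c + s * b)" if "0 \<le> s" for s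
  proof (rule field_le_epsilon)
    fix e :: real assume "e > 0"
    then have "\<beta> \<le> p \<bullet> (xb + s *\<^sub>R d) + q * (c + s * b - e / (- q))"
      using q that by (intro T) (simp_all add: field_simps)
    also have "q * (c + s * b - e / (- q)) = q * (c + s * b) + e"
      using q by (simp add: field_simps)
    finally show "\<beta> \<le> p \<bullet> (xb + s *\<^sub>R d) + q * (c + s * b) + e" by simp
  qed
  have \<beta>: "\<beta> = p \<bullet> xb + q * c"
    using ray[of 0] S[of xb c] c by simp
  define w where "w = (1 / (- q)) *\<^sub>R p"
  have p: "p = (- q) *\<^sub>R w" using q by (simp add: w_def)
  have "(x - xb) \<bullet> w \<le> r - c" if "f x \<le> ereal r" for x r
  proof -
    have "(- q) * ((x - xb) \<bullet> w) \<le> (- q) * (r - c)"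
      using S[OF that] unfolding \<beta> p by (simp add: inner_commute algebra_simps)
    then show ?thesis using q by simp
  qed
  then have "w \<in> subdifferential f xb"
    unfolding subdifferential_halfspaces[of f, OF c] by blast
  moreover have "b \<le> w \<bullet> d"
  proof -
    have "(- q) * b \<le> (- q) * (w \<bullet> d)"
      using ray[of 1] unfolding \<beta> p by (simp add: inner_add_right algebra_simps)
    then show ?thesis using q by simp
  qed
  ultimately show thesis by (rule that)
qed

text \<open>
  By the preceding lemma the graph falls below the ray of slope \<open>b\<close> at some step \<open>s0\<close>. The chord from
  \<open>xb\<close> to that point lies below the ray, and convexity puts the graph below the chord on the whole
  segment.
\<close>

lemma eventually_below_slope:
  fixes f :: "'a::euclidean_space \<Rightarrow> ereal"
  assumes conv: "ext_convex f" and dom: "xb \<in> effdom f" and cont: "isCont f xb"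
    and sub: "\<And>w. w \<in> subdifferential f xb \<Longrightarrow> w \<bullet> d < b"
  shows "\<forall>\<^sub>F s in at_right 0. f (xb + s *\<^sub>R d) \<le> f xb + ereal (s * b)"
proof -
  obtain c where c: "f xb = ereal c" using ext_convex_real_value conv dom by blast
  obtain s0 where s0: "s0 > 0" "f (xb + s0 *\<^sub>R d) < f xb + ereal (s0 * b)"
    using subgradient_of_slope[OF conv dom cont] sub by (metis not_le)
  have "f (xb + s *\<^sub>R d) \<le> f xb + ereal (s * b)" if s: "0 < s" "s < s0" for s
  proof -
    define t where "t = s / s0"
    have t: "0 < t" "t < 1" "s = t * s0" using s s0 by (simp_all add: t_def)
    have "xb + s *\<^sub>R d = t *\<^sub>R (xb + s0 *\<^sub>R d) + (1 - t) *\<^sub>R xb"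
      by (simp add: t algebra_simps)
    then have "f (xb + s *\<^sub>R d) \<le> ereal t * f (xb + s0 *\<^sub>R d) + ereal (1 - t) * f xb"
      using ext_convexD[OF conv t(1,2), of "xb + s0 *\<^sub>R d" xb] by simp
    also have "\<dots> \<le> ereal t * (f xb + ereal (s0 * b)) + ereal (1 - t) * f xb"
      using s0 t by (intro add_right_mono ereal_mult_left_mono) auto
    also have "\<dots> = f xb + ereal (s * b)" using c t by (simp add: algebra_simps)
    finally show ?thesis .
  qed
  then show ?thesis using s0(1) unfolding eventually_at_right_field by blast
qed

lemma eventually_below_ray_of_less:
  fixes f :: "'a::real_normed_vector \<Rightarrow> ereal"
  assumes cont: "isCont f xb" and less: "f xb < ereal c"
  shows "\<forall>\<^sub>F s in at_right 0. f (xb + s *\<^sub>R d) \<le> ereal (c + s * b)"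
proof -
  obtain \<mu> where \<mu>: "f xb < ereal \<mu>" "\<mu> < c" using ereal_dense2[OF less] by auto
  have "((\<lambda>s::real. xb + s *\<^sub>R d) \<longlongrightarrow> xb + 0 *\<^sub>R d) (at_right 0)"
    by (intro tendsto_intros)
  then have "((\<lambda>s::real. f (xb + s *\<^sub>R d)) \<longlongrightarrow> f xb) (at_right 0)"
    using isCont_tendsto_compose[OF cont] by simp
  then have "\<forall>\<^sub>F s in at_right 0. f (xb + s *\<^sub>R d) < ereal \<mu>"
    using \<mu> by (rule_tac order_tendstoD(2))
  moreover have "((\<lambda>s::real. c + s * b) \<longlongrightarrow> c + 0 * b) (at_right 0)"
    by (intro tendsto_intros)
  then have "\<forall>\<^sub>F s in at_right 0. \<mu> < c + s * b"
    using \<mu> by (intro order_tendstoD(1)[where y = c]) simp_all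
  ultimately show ?thesis
    by eventually_elim (metis ereal_less_eq(3) less_imp_le order_trans)
qed

section \<open>The subdifferential of a maximum\<close>

lemma max_fun_ge: "i \<in> {1..m} \<Longrightarrow> f i x \<le> max_fun m f x"
  unfolding max_fun_def by (rule Max_ge) auto

lemma max_fun_le_iff: "m \<ge> 1 \<Longrightarrow> max_fun m f x \<le> y \<longleftrightarrow> (\<forall>i\<in>{1..m}. f i x \<le> y)"
  unfolding max_fun_def by (subst Max_le_iff) auto

lemma max_fun_attained:
  assumes "m \<ge> 1" obtains i where "i \<in> {1..m}" "max_fun m f x = f i x"
proof -
  have "max_fun m f x \<in> (\<lambda>i. f i x) ` {1..m}"
    unfolding max_fun_def using assms by (intro Max_in) auto
  then show thesis using that by blast
qed

theorem theorem8p2: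
  fixes f :: "nat \<Rightarrow> real ^ 'n \<Rightarrow> ereal"
    and m :: nat
    and xb :: "real ^ 'n"
  assumes "m \<ge> 1"
    and "\<And>i. i \<in> {1..m} \<Longrightarrow> ext_convex (f i)"
    and "xb \<in> (\<Inter>i\<in>{1..m}. effdom (f i))"
    and "\<And>i. i \<in> {1..m} \<Longrightarrow> isCont (f i) xb"
  shows "subdifferential (max_fun m f) xb =
         convex hull (\<Union>i\<in>active_indices m f xb. subdifferential (f i) xb)"
    (is "?L = convex hull ?U")
proof
  have dom: "xb \<in> effdom (f i)" if "i \<in> {1..m}" for i using assms(3) that by blast
  obtain c where c: "max_fun m f xb = ereal c"
    using max_fun_attained[OF assms(1), of f xb] ext_convex_real_value[OF assms(2) dom] by metis
  have "?U \<subseteq> ?L"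
    unfolding subdifferential_def active_indices_def
    by (auto intro: order_trans[OF _ max_fun_ge])
  then show "convex hull ?U \<subseteq> ?L"
    by (rule hull_minimal) (rule convex_subdifferential[of "max_fun m f", OF c])
  show "?L \<subseteq> convex hull ?U"
  proof (rule subsetI, rule ccontr)
    fix v assume v: "v \<in> ?L" and notin: "v \<notin> convex hull ?U"
    have "compact ?U"
      using assms(2,4) dom by (intro compact_UN) (auto simp: active_indices_def compact_subdifferential)
    then have "closed (convex hull ?U)" by (intro compact_imp_closed compact_convex_hull)
    then obtain a \<beta> where "a \<bullet> v < \<beta>" and "\<And>w. w \<in> convex hull ?U \<Longrightarrow> \<beta> < a \<bullet> w"
      using separating_hyperplane_closed_point[OF convex_convex_hull _ notin] by blast
    moreover define d b where "d = - a" and "b = - \<beta>"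
    ultimately have vd: "b < v \<bullet> d" and wd: "\<And>w. w \<in> ?U \<Longrightarrow> w \<bullet> d < b"
      by (auto simp: inner_commute hull_inc)
    have "\<forall>\<^sub>F s in at_right 0. f i (xb + s *\<^sub>R d) \<le> ereal (c + s * b)" if i: "i \<in> {1..m}" for i
    proof (cases "f i xb = ereal c")
      case True
      then have "i \<in> active_indices m f xb" using i c by (simp add: active_indices_def)
      then have "\<forall>\<^sub>F s in at_right 0. f i (xb + s *\<^sub>R d) \<le> f i xb + ereal (s * b)"
        using wd by (intro eventually_below_slope assms(2,4) dom i) blast
      then show ?thesis by (simp add: True)
    next
      case False
      then have "f i xb < ereal c" using max_fun_ge[OF i, of f xb] c by simp
      then show ?thesis using i assms(4) by (intro eventually_below_ray_of_less)
    qed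
    then have "\<forall>\<^sub>F s in at_right 0. \<forall>i\<in>{1..m}. f i (xb + s *\<^sub>R d) \<le> ereal (c + s * b)"
      by (intro eventually_ball_finite) auto
    then obtain s where s: "s > 0" "max_fun m f (xb + s *\<^sub>R d) \<le> ereal (c + s * b)"
      unfolding eventually_at_right_field max_fun_le_iff[OF assms(1)]
      by (metis dense)
    then have "s * (v \<bullet> d) \<le> s * b"
      using v unfolding subdifferential_halfspaces[of "max_fun m f", OF c]
      by (force simp: inner_commute)
    then show False using s vd by simp
  qed
qed

end
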